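(* There exists a family $\{X_\alpha\}_{\alpha\in[0,1]}$ of uniformly distributed random variables $X_\alpha:\Omega_\alpha\to[0,1]$, defined on probability spaces $\{(\Omega_\alpha,\mathcal{F}_\alpha,\mathbb{P}_\alpha)\}_{\alpha\in[0,1]}$, such that for all $\alpha,\beta\in[0,1]$ with $\alpha\neq\beta$ we have \[ \lambda_*\bigl(X_\alpha(\Omega_\alpha)\cap X_\beta(\Omega_\beta)\bigr)=\min(\alpha,\beta)\quad\text{and}\quad \lambda^*\bigl(X_\alpha(\Omega_\alpha)\cap X_\beta(\Omega_\beta)\bigr)=\max(\alpha,\beta). \]
   Context: $\mathcal{B}[0,1]$ denotes the Borel $\sigma$-algebra on $[0,1]$ and $\lambda$ denotes Lebesgue measure on $[0,1]$ restricted to Borel sets. $\lambda_*$ and $\lambda^*$ denote Lebesgue inner and outer measure respectively: for $S\subseteq[0,1]$, $\lambda_*(S)=\sup\{\lambda(B):B\in\mathcal{B}[0,1],\,B\subseteq S\}$ and $\lambda^*(S)=\inf\{\lambda(B):B\in\mathcal{B}[0,1],\,S\subseteq B\}$. A random variable $X:\Omega\to[0,1]$ on a probability space $(\Omega,\mathcal{F},\mathbb{P})$, i.e. a function measurable from $\mathcal{F}$ to $\mathcal{B}[0,1]$, is called uniformly distributed if $\mathbb{P}(X^{-1}(A))=\lambda(A)$ for all $A\in\mathcal{B}[0,1]$. Random variables may be defined on different probability spaces. $X(\Omega)$ denotes the image (range) of the function $X$. *)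

theory Defs
  imports "HOL-Probability.Probability"
begin

abbreviation unit_lborel :: "real measure" where
  "unit_lborel \<equiv> restrict_space lborel {0..1}"

text \<open>Inner counterpart of the library constant \<^const>\<open>outer_measure_of\<close>.\<close>

definition inner_measure_of :: "'a measure \<Rightarrow> 'a set \<Rightarrow> ennreal" where
  "inner_measure_of M A = (SUP B\<in>{B \<in> sets M. B \<subseteq> A}. emeasure M B)"

definition uniformly_distributed :: "'a measure \<Rightarrow> ('a \<Rightarrow> real) \<Rightarrow> bool" where
  "uniformly_distributed M X \<longleftrightarrow>
     X \<in> M \<rightarrow>\<^sub>M unit_lborel \<and>
     (\<forall>A\<in>sets unit_lborel. emeasure M (X -` A \<inter> space M) = emeasure unit_lborel A)"

end

theory Submission
  imports Defs
begin

text \<open>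
  A set \<open>S \<subseteq> [0,1]\<close> is the range of a uniformly distributed random variable as soon as it is thick,
  that is, as soon as its complement contains no Borel set of positive measure: the traces on \<open>S\<close> of
  the Borel sets carry the outer measure as a probability measure, and the inclusion
  \<open>S \<rightarrow> [0,1]\<close> is uniformly distributed for it. So a suitable family of thick sets is all that is
  needed.

  There are pairwise disjoint thick sets \<open>T\<^sub>\<alpha>\<close>, one for each real \<open>\<alpha>\<close>. Indeed there are only continuum many pairs
  \<open>(K, \<alpha>)\<close> of a closed \<open>K \<subseteq> [0,1]\<close> of positive measure and an index, while each such \<open>K\<close> has
  continuum many points (lemma \<open>real_lepoll_closed_pos_measure\<close>). Transfinite recursion therefore
  selects points \<open>f (K, \<alpha>) \<in> K\<close> that are distinct for distinct pairs (lemma \<open>injective_choice\<close>), and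
  \<open>T\<^sub>\<alpha> = {f (K, \<alpha>) | K}\<close> meets every \<open>K\<close>. By inner regularity of Lebesgue measure this makes
  \<open>T\<^sub>\<alpha>\<close> thick.

  For \<open>\<alpha> \<in> [0,1]\<close> put \<open>S\<^sub>\<alpha> = [0,\<alpha>] \<union> T\<^sub>\<alpha>\<close>. For \<open>\<alpha> < \<beta>\<close> disjointness of \<open>T\<^sub>\<alpha>\<close> and \<open>T\<^sub>\<beta>\<close> gives
  \<open>S\<^sub>\<alpha> \<inter> S\<^sub>\<beta> = [0,\<alpha>] \<union> (T\<^sub>\<alpha> \<inter> [0,\<beta>])\<close>. Its inner measure is \<open>\<alpha>\<close>, since a Borel subset of \<open>T\<^sub>\<alpha>\<close> misses
  \<open>T\<^sub>\<beta>\<close> and hence is null; its outer measure is \<open>\<beta>\<close>, since \<open>T\<^sub>\<alpha>\<close> is thick.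
\<close>

section \<open>Thick sets and trace measures\<close>

text \<open>For a probability space this says that \<open>S\<close> has outer measure 1.\<close>

definition thick :: "'a measure \<Rightarrow> 'a set \<Rightarrow> bool" where
  "thick M S \<longleftrightarrow> S \<subseteq> space M \<and> (\<forall>N\<in>sets M. N \<inter> S = {} \<longrightarrow> emeasure M N = 0)"

lemma thick_mono: "thick M S \<Longrightarrow> S \<subseteq> S' \<Longrightarrow> S' \<subseteq> space M \<Longrightarrow> thick M S'"
  unfolding thick_def by blast

text \<open>The trace of \<open>M\<close> on a possibly non-measurable set. \<^const>\<open>restrict_space\<close> has the right
  sigma-algebra, but its measure is not meaningful when \<open>S\<close> is not measurable.\<close>

definition trace_measure :: "'a measure \<Rightarrow> 'a set \<Rightarrow> 'a measure" where
  "trace_measure M S = measure_of S ((\<inter>) S ` sets M) (outer_measure_of M)"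

lemma outer_measure_of_thick_Int:
  assumes S: "thick M S" and B: "B \<in> sets M"
  shows "outer_measure_of M (S \<inter> B) = emeasure M B"
proof (rule antisym)
  show "outer_measure_of M (S \<inter> B) \<le> emeasure M B"
    using outer_measure_of_mono[of "S \<inter> B" B M] B by simp
  have "emeasure M B \<le> emeasure M C" if C: "C \<in> sets M" "S \<inter> B \<subseteq> C" for C
  proof -
    have "(B - C) \<inter> S = {}" "B - C \<in> sets M"
      using B C by auto
    then have "emeasure M (B - C) = 0"
      using S by (simp add: thick_def)
    then have "emeasure M B = emeasure M (B - (B - C))"
      using B C by (intro emeasure_Diff_null_set[symmetric]) auto
    also have "\<dots> \<le> emeasure M C"
      using C by (intro emeasure_mono) auto
    finally show ?thesis .
  qed
  then show "emeasure M B \<le> outer_measure_of M (S \<inter> B)"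
    unfolding outer_measure_of_def by (intro INF_greatest) auto
qed

lemma space_trace_measure: "S \<subseteq> space M \<Longrightarrow> space (trace_measure M S) = S"
  unfolding trace_measure_def by (simp add: space_measure_of_conv)

lemma sets_trace_measure:
  assumes "S \<subseteq> space M"
  shows "sets (trace_measure M S) = (\<inter>) S ` sets M"
proof -
  have "sigma_sets S ((\<inter>) S ` sets M) = (\<inter>) S ` sets M"
    using assms sets.restricted_sigma_algebra[of S M] sets_restrict_space[of M S]
    by (metis Int_absorb2 sets.sigma_sets_eq space_restrict_space)
  then show ?thesis
    unfolding trace_measure_def by (subst sets_measure_of) auto
qed

lemma emeasure_trace_measure:
  assumes S: "thick M S" and B: "B \<in> sets M"
  shows "emeasure (trace_measure M S) (S \<inter> B) = emeasure M B"
proof -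
  have SM: "S \<subseteq> space M"
    using S by (simp add: thick_def)
  have "emeasure (trace_measure M S) (S \<inter> B) = outer_measure_of M (S \<inter> B)"
  proof (rule emeasure_measure_of[OF trace_measure_def])
    show "positive (sets (trace_measure M S)) (outer_measure_of M)"
      by (simp add: positive_def)
    show "countably_additive (sets (trace_measure M S)) (outer_measure_of M)"
    proof (rule countably_additiveI)
      fix A :: "nat \<Rightarrow> 'a set"
      assume A: "range A \<subseteq> sets (trace_measure M S)" and disj: "disjoint_family A"
      have "\<forall>i. \<exists>B\<in>sets M. A i = S \<inter> B"
        using A unfolding sets_trace_measure[OF SM] by (auto simp: image_subset_iff)
      then obtain B where B: "\<And>i. B i \<in> sets M" "\<And>i. A i = S \<inter> B i"
        by metis
      \<comment> \<open>The sets \<open>B i\<close> overlap outside \<open>S\<close> only, so making them disjoint keeps their traces.\<close>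
      have D: "A i = S \<inter> disjointed B i" for i
      proof -
        have "A i \<inter> A j = {}" if "j < i" for j
          using disj that by (simp add: disjoint_family_on_def)
        then have "S \<inter> B i \<inter> B j = {}" if "j < i" for j
          using that unfolding B(2) by blast
        then show ?thesis
          unfolding B(2) disjointed_def by fastforce
      qed
      have DM: "disjointed B i \<in> sets M" for i
        using sets.range_disjointed_sets[of B M] B by auto
      have "(\<Sum>i. outer_measure_of M (A i)) = (\<Sum>i. emeasure M (disjointed B i))"
        using outer_measure_of_thick_Int[OF S DM] by (simp add: D)
      also have "\<dots> = emeasure M (\<Union>i. disjointed B i)"
        using DM by (intro suminf_emeasure disjoint_family_disjointed) auto
      also have "\<dots> = outer_measure_of M (S \<inter> (\<Union>i. disjointed B i))"
        using DM by (intro outer_measure_of_thick_Int[OF S, symmetric]) auto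
      also have "S \<inter> (\<Union>i. disjointed B i) = (\<Union>i. A i)"
        using D by auto
      finally show "(\<Sum>i. outer_measure_of M (A i)) = outer_measure_of M (\<Union>i. A i)" .
    qed
  qed (use B sets_trace_measure[OF SM] in auto)
  then show ?thesis
    using outer_measure_of_thick_Int[OF S B] by simp
qed

lemma prob_space_trace_measure:
  assumes "prob_space M" "thick M S"
  shows "prob_space (trace_measure M S)"
proof
  have "S \<inter> space M = S"
    using assms(2) by (auto simp: thick_def)
  then show "emeasure (trace_measure M S) (space (trace_measure M S)) = 1"
    using emeasure_trace_measure[OF assms(2) sets.top] space_trace_measure[of S M] assms
    by (simp add: thick_def prob_space.emeasure_space_1)
qed

lemma uniformly_distributed_trace_measure:
  assumes "thick unit_lborel S"
  shows "uniformly_distributed (trace_measure unit_lborel S) (\<lambda>x. x)"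
proof -
  have S: "S \<subseteq> space unit_lborel"
    using assms by (simp add: thick_def)
  show ?thesis
    unfolding uniformly_distributed_def measurable_def
    using S emeasure_trace_measure[OF assms] space_trace_measure[OF S] sets_trace_measure[OF S]
    by (auto simp: Int_commute)
qed

section \<open>Distinct representatives\<close>

text \<open>Well-order \<open>I\<close> by its cardinal, so that every proper initial segment is smaller than \<open>I\<close>, and
  pick each \<open>f i\<close> outside the values already used.\<close>

lemma injective_choice:
  includes cardinal_syntax
  assumes le: "\<And>i. i \<in> I \<Longrightarrow> I \<lesssim> A i"
  obtains f where "inj_on f I" "\<And>i. i \<in> I \<Longrightarrow> f i \<in> A i"
proof -
  define r where "r = card_of I"
  have r: "Card_order r" "Field r = I"
    unfolding r_def by (rule card_of_Card_order, rule Field_card_of)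
  interpret wo_rel r
    unfolding wo_rel_def using r(1) by (rule card_order_on_well_order_on)
  define H where "H f i = (SOME x. x \<in> A i - f ` underS i)" for f :: "'a \<Rightarrow> 'b" and i
  define f where "f = worec H"
  have "adm_wo H"
    unfolding adm_wo_def H_def by (metis image_cong)
  then have f: "f i = H f i" for i
    unfolding f_def by (metis worec_fixpoint)
  have mem: "f i \<in> A i - f ` underS i" if i: "i \<in> I" for i
  proof -
    have "card_of (f ` underS i) \<le>o card_of (underS i)"
      by (rule card_of_image)
    also have "card_of (underS i) <o r"
      using card_of_underS r i by metis
    also have "r \<le>o card_of (A i)"
      using le[OF i] by (simp add: lepoll_def r_def card_of_ordLeq)
    finally have "\<not> A i \<subseteq> f ` underS i"
      using card_of_mono1 not_ordLess_ordLeq by blast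
    then have "\<exists>x. x \<in> A i - f ` underS i"
      by blast
    then show ?thesis
      unfolding f[of i] H_def by (rule someI_ex)
  qed
  have "inj_on f I"
  proof (rule inj_onI, rule ccontr)
    fix i j assume ij: "i \<in> I" "j \<in> I" "f i = f j" "i \<noteq> j"
    then have "i \<in> underS j \<or> j \<in> underS i"
      using TOTALS r(2) by (auto simp: underS_def)
    then show False
      using mem[OF ij(1)] mem[OF ij(2)] ij(3) by (metis DiffE imageI)
  qed
  then show thesis
    using mem that by blast
qed

section \<open>Closed sets of positive measure\<close>

text \<open>A closed set is determined by the basic open sets, from a countable base, that make up its
  complement.\<close>

lemma closed_sets_lepoll_real: "{K :: real set. closed K} \<lesssim> (UNIV :: real set)"
proof -
  obtain B :: "nat \<Rightarrow> real set"
    where "inj B" "\<And>n. open (B n)" and B: "\<And>S. open S \<Longrightarrow> \<exists>k. S = \<Union>{B n |n. n \<in> k}"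
    by (rule univ_second_countable_sequence) blast
  define k where "k S = (SOME k. S = \<Union>{B n |n. n \<in> k})" for S
  have k: "S = \<Union>{B n |n. n \<in> k S}" if "open S" for S
    unfolding k_def using B[OF that] by (rule someI_ex)
  have "inj_on (\<lambda>K. k (- K)) {K. closed K}"
  proof (rule inj_onI)
    fix K L assume KL: "K \<in> {K. closed K}" "L \<in> {K. closed K}" "k (- K) = k (- L)"
    then have "- K = \<Union>{B n |n. n \<in> k (- K)}"
      by (intro k) auto
    also have "\<dots> = - L"
      unfolding KL(3) using KL(2) by (intro k[symmetric]) auto
    finally have "- K = - L" .
    then show "K = L"
      by simp
  qed
  then have "{K :: real set. closed K} \<lesssim> (UNIV :: nat set set)"
    unfolding lepoll_def by blast
  then show ?thesis
    using nat_sets_eqpoll_reals lepoll_trans2 by blast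
qed

text \<open>The distribution function \<open>F x = \<lambda>(K \<inter> [0,x])\<close> is continuous, and it is locally constant off
  \<open>K\<close>, with \<open>F 0 = 0\<close>; so every value in \<open>(0, \<lambda>(K))\<close> is taken at a point of \<open>K\<close>, namely at the first point where it
  is taken at all.\<close>

lemma real_lepoll_closed_pos_measure:
  fixes K :: "real set"
  assumes K: "closed K" "K \<subseteq> {0..1}" and pos: "emeasure lborel K > 0"
  shows "(UNIV :: real set) \<lesssim> K"
proof -
  define F where "F x = measure lborel (K \<inter> {0..x})" for x
  have Kb: "K \<in> sets borel"
    using K by simp
  have Icc: "{a..b} \<in> fmeasurable lborel" for a b :: real
    by (cases "a \<le> b") (auto simp: fmeasurable_def)
  have fin: "K \<inter> {a..b} \<in> fmeasurable lborel" "K \<inter> {a<..b} \<in> fmeasurable lborel" for a b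
    by (rule fmeasurableI2[OF Icc[of a b]]; auto simp: Kb)+
  have split: "F y = F x + measure lborel (K \<inter> {x<..y})" if "0 \<le> x" "x \<le> y" for x y
  proof -
    have "K \<inter> {0..y} = (K \<inter> {0..x}) \<union> (K \<inter> {x<..y})"
      using that by auto
    then show ?thesis
      unfolding F_def using fin by (simp only:) (rule measure_Un_AE, auto simp: fmeasurable_def)
  qed
  have lip: "dist (F x) (F y) \<le> dist x y" if "0 \<le> x" "x \<le> y" for x y
  proof -
    have "measure lborel (K \<inter> {x<..y}) \<le> measure lborel {x..y}"
      by (intro measure_mono_fmeasurable) (use Icc Kb in auto)
    then show ?thesis
      using split[OF that] that by (simp add: dist_real_def)
  qed
  have cont: "continuous_on {0..1} F"
    unfolding continuous_on_iff
    using lip by (metis atLeastAtMost_iff dist_commute le_less_trans linear)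
  have F0: "F 0 = 0"
    by (cases "0 \<in> K") (auto simp: F_def)
  have F1: "F 1 > 0"
  proof -
    have "K \<inter> {0..1} = K"
      using K by auto
    moreover have "emeasure lborel K = ennreal (measure lborel K)"
      using fin(1)[of 0 1] calculation by (metis emeasure_eq_measure2)
    ultimately show ?thesis
      using pos unfolding F_def by simp
  qed
  have "\<exists>x\<in>K. F x = y" if y: "0 < y" "y < F 1" for y
  proof -
    define A where "A = {x \<in> {0..1}. F x = y}"
    have "closed A"
      unfolding A_def using continuous_closed_preimage_constant[OF cont] by simp
    moreover have "A \<noteq> {}"
      using IVT'[of F 0 y 1] cont y F0 unfolding A_def by auto
    moreover have bdd: "bdd_below A"
      unfolding A_def by (auto intro: bdd_belowI[of _ 0])
    ultimately have x: "Inf A \<in> A"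
      by (intro closed_contains_Inf)
    define x where "x = Inf A"
    have xA: "0 \<le> x" "x \<le> 1" "F x = y"
      using x unfolding A_def x_def by auto
    have "x \<in> K"
    proof (rule ccontr)
      assume "x \<notin> K"
      then obtain e where e: "e > 0" "ball x e \<subseteq> - K"
        using K(1) by (metis ComplI open_Compl openE)
      have "x > 0"
        using xA F0 y by (cases "x = 0") auto
      define x' where "x' = max 0 (x - e / 2)"
      have x': "0 \<le> x'" "x' < x" "x - e < x'"
        using e(1) \<open>x > 0\<close> by (auto simp: x'_def)
      then have "{x'<..x} \<subseteq> ball x e"
        by (auto simp: dist_real_def)
      then have "K \<inter> {x'<..x} = {}"
        using e(2) by blast
      then have "F x' = y"
        using split[of x' x] x' xA by simp
      then have "x' \<in> A"
        using x' xA by (simp add: A_def)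
      then have "x \<le> x'"
        unfolding x_def using bdd by (rule cInf_lower)
      then show False
        using x' by simp
    qed
    then show ?thesis
      using xA by auto
  qed
  then have "{0<..<F 1} \<subseteq> F ` K"
    by (auto simp: image_iff) metis
  then have "{0<..<F 1} \<lesssim> K"
    by (meson image_lepoll lepoll_trans subset_imp_lepoll)
  moreover have "(UNIV :: real set) \<lesssim> {0<..<F 1}"
    using open_interval_eqpoll_reals[of 0 "F 1"] F1 by (simp add: eqpoll_imp_lepoll eqpoll_sym)
  ultimately show ?thesis
    by (rule lepoll_trans[rotated])
qed

section \<open>Disjoint thick sets\<close>

lemma ex_closed_subset_pos_measure:
  assumes N: "N \<in> sets unit_lborel" "emeasure unit_lborel N \<noteq> 0"
  obtains K where "closed K" "K \<subseteq> N" "emeasure lborel K > 0"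
proof -
  have N': "N \<in> sets borel" "N \<subseteq> {0..1}"
    using N(1) by (auto simp: sets_restrict_space)
  have e: "emeasure lborel N > 0"
    using N(2) N'(2) by (simp add: emeasure_restrict_space zero_less_iff_neq_zero)
  \<comment> \<open>Inner regularity is for finite Borel measures, so Lebesgue measure is cut down to the unit interval.\<close>
  define M where "M = density lborel (indicator {0..1::real})"
  have M: "emeasure M A = emeasure lborel (A \<inter> {0..1})" if "A \<in> sets borel" for A
    unfolding M_def using that by (simp add: emeasure_density flip: indicator_inter_arith)
       (metis Int_commute)
  have "(SUP K \<in> {K. K \<subseteq> N \<and> compact K}. emeasure M K) = emeasure M N"
    by (rule inner_regular[symmetric]) (use N' M[of UNIV] in \<open>auto simp: M_def\<close>)
  then have "0 < (SUP K \<in> {K. K \<subseteq> N \<and> compact K}. emeasure M K)"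
    using M[of N] N' e by (simp add: Int_absorb2)
  then obtain K where K: "K \<subseteq> N" "compact K" "0 < emeasure M K"
    by (auto simp: less_SUP_iff)
  then have "emeasure lborel K > 0"
    using M[of K] N'(2) by (simp add: Int_absorb2 borel_compact)
  then show thesis
    using K that compact_imp_closed by blast
qed

lemma ex_disjoint_thick_sets:
  obtains T :: "real \<Rightarrow> real set" where "\<And>\<alpha>. thick unit_lborel (T \<alpha>)" "disjoint_family T"
proof -
  define C where "C = {K :: real set. closed K \<and> K \<subseteq> {0..1} \<and> emeasure lborel K > 0}"
  define I where "I = C \<times> (UNIV :: real set)"
  have "C \<lesssim> (UNIV :: real set)"
    by (rule lepoll_trans[OF subset_imp_lepoll closed_sets_lepoll_real]) (auto simp: C_def)
  then have "I \<lesssim> (UNIV :: real set) \<times> (UNIV :: real set)"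
    unfolding I_def by (intro times_lepoll_mono) auto
  also have "\<dots> \<approx> (UNIV :: real set)"
    using card_of_Times_same_infinite[of "UNIV :: real set"]
    by (simp add: eqpoll_iff_card_of_ordIso infinite_UNIV_char_0)
  finally have I: "I \<lesssim> (UNIV :: real set)" .
  have "I \<lesssim> fst i" if "i \<in> I" for i
    using that lepoll_trans[OF I real_lepoll_closed_pos_measure] by (auto simp: I_def C_def)
  then obtain f where f: "inj_on f I" "\<And>i. i \<in> I \<Longrightarrow> f i \<in> fst i"
    using injective_choice[of I fst] by blast
  define T where "T \<alpha> = (\<lambda>K. f (K, \<alpha>)) ` C" for \<alpha>
  have meets: "f (K, \<alpha>) \<in> K \<inter> T \<alpha>" if "K \<in> C" for K \<alpha>
    using f(2)[of "(K, \<alpha>)"] that by (auto simp: T_def I_def)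
  show thesis
  proof
    show "thick unit_lborel (T \<alpha>)" for \<alpha>
      unfolding thick_def
    proof (intro conjI ballI impI)
      show "T \<alpha> \<subseteq> space unit_lborel"
      proof
        fix x assume "x \<in> T \<alpha>"
        then obtain K where "K \<in> C" "x = f (K, \<alpha>)"
          by (auto simp: T_def)
        then show "x \<in> space unit_lborel"
          using meets[of K \<alpha>] by (auto simp: C_def)
      qed
      fix N assume N: "N \<in> sets unit_lborel" "N \<inter> T \<alpha> = {}"
      show "emeasure unit_lborel N = 0"
      proof (rule ccontr)
        assume "emeasure unit_lborel N \<noteq> 0"
        then obtain K where K: "closed K" "K \<subseteq> N" "emeasure lborel K > 0"
          using N(1) ex_closed_subset_pos_measure by blast
        moreover have "N \<subseteq> {0..1}"
          using N(1) by (auto simp: sets_restrict_space)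
        ultimately have "K \<in> C"
          by (auto simp: C_def)
        then show False
          using meets[of K \<alpha>] K N by blast
      qed
    qed
    show "disjoint_family T"
      unfolding disjoint_family_on_def T_def
      using f(1) by (auto simp: inj_on_def I_def)
  qed
qed

section \<open>The family of random variables\<close>

lemma sets_unit_lborel: "A \<in> sets unit_lborel \<longleftrightarrow> A \<in> sets borel \<and> A \<subseteq> {0..1}"
  by (auto simp: sets_restrict_space_iff)

lemma emeasure_unit_lborel_Icc:
  assumes "0 \<le> a" "a \<le> 1"
  shows "emeasure unit_lborel {0..a} = ennreal a"
  using assms by (simp add: emeasure_restrict_space)

lemma inner_outer_measure_Int:
  assumes T: "thick unit_lborel T" "thick unit_lborel T'" "T \<inter> T' = {}"
    and ab: "0 \<le> \<alpha>" "\<alpha> < \<beta>" "\<beta> \<le> 1"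
  shows "inner_measure_of unit_lborel (({0..\<alpha>} \<union> T) \<inter> ({0..\<beta>} \<union> T')) = ennreal \<alpha>" (is ?inner)
    and "outer_measure_of unit_lborel (({0..\<alpha>} \<union> T) \<inter> ({0..\<beta>} \<union> T')) = ennreal \<beta>" (is ?outer)
proof -
  have eq: "({0..\<alpha>} \<union> T) \<inter> ({0..\<beta>} \<union> T') = {0..\<alpha>} \<union> (T \<inter> {0..\<beta>})" (is "_ = ?Q")
    using T(3) ab by auto
  have Icc: "{0..\<alpha>} \<in> sets unit_lborel" "{0..\<beta>} \<in> sets unit_lborel"
    using ab by (auto simp: sets_unit_lborel)
  have "inner_measure_of unit_lborel ?Q = emeasure unit_lborel {0..\<alpha>}"
    unfolding inner_measure_of_def
  proof (rule SUP_eqI)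
    fix B assume "B \<in> {B \<in> sets unit_lborel. B \<subseteq> ?Q}"
    then have B: "B \<in> sets unit_lborel" "B \<subseteq> ?Q"
      by auto
    then have "(B - {0..\<alpha>}) \<inter> T' = {}"
      using T(3) by auto
    then have "emeasure unit_lborel (B - {0..\<alpha>}) = 0"
      using T(2) B(1) Icc unfolding thick_def by blast
    then have "emeasure unit_lborel B = emeasure unit_lborel (B - (B - {0..\<alpha>}))"
      using B(1) Icc by (intro emeasure_Diff_null_set[symmetric]) auto
    also have "\<dots> \<le> emeasure unit_lborel {0..\<alpha>}"
      using Icc by (intro emeasure_mono) auto
    finally show "emeasure unit_lborel B \<le> emeasure unit_lborel {0..\<alpha>}" .
  qed (use Icc in auto)
  then show ?inner
    using eq emeasure_unit_lborel_Icc ab by simp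
  have "outer_measure_of unit_lborel ?Q = emeasure unit_lborel {0..\<beta>}"
  proof (rule antisym)
    show "outer_measure_of unit_lborel ?Q \<le> emeasure unit_lborel {0..\<beta>}"
      using outer_measure_of_mono[of ?Q "{0..\<beta>}" unit_lborel] Icc(2) ab by auto
    have "emeasure unit_lborel {0..\<beta>} = outer_measure_of unit_lborel (T \<inter> {0..\<beta>})"
      using outer_measure_of_thick_Int[OF T(1) Icc(2)] by simp
    also have "\<dots> \<le> outer_measure_of unit_lborel ?Q"
      by (intro outer_measure_of_mono) auto
    finally show "emeasure unit_lborel {0..\<beta>} \<le> outer_measure_of unit_lborel ?Q" .
  qed
  then show ?outer
    using eq emeasure_unit_lborel_Icc ab by simp
qed

theorem theorem5:
  shows "\<exists>(M :: real \<Rightarrow> real measure) (X :: real \<Rightarrow> real \<Rightarrow> real).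
    (\<forall>\<alpha>\<in>{0..1}. prob_space (M \<alpha>) \<and> uniformly_distributed (M \<alpha>) (X \<alpha>)) \<and>
    (\<forall>\<alpha>\<in>{0..1}. \<forall>\<beta>\<in>{0..1}. \<alpha> \<noteq> \<beta> \<longrightarrow>
       inner_measure_of unit_lborel (X \<alpha> ` space (M \<alpha>) \<inter> X \<beta> ` space (M \<beta>)) = ennreal (min \<alpha> \<beta>) \<and>
       outer_measure_of unit_lborel (X \<alpha> ` space (M \<alpha>) \<inter> X \<beta> ` space (M \<beta>)) = ennreal (max \<alpha> \<beta>))"
proof -
  obtain T :: "real \<Rightarrow> real set"
    where T: "\<And>\<alpha>. thick unit_lborel (T \<alpha>)" "disjoint_family T"
    by (rule ex_disjoint_thick_sets) blast
  have disj: "T \<alpha> \<inter> T \<beta> = {}" if "\<alpha> \<noteq> \<beta>" for \<alpha> \<beta>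
    using T(2) that by (auto simp: disjoint_family_on_def)
  define S where "S \<alpha> = {0..\<alpha>} \<union> T \<alpha>" for \<alpha>
  define M where "M \<alpha> = trace_measure unit_lborel (S \<alpha>)" for \<alpha>
  have S: "thick unit_lborel (S \<alpha>)" if "\<alpha> \<in> {0..1}" for \<alpha>
    using T(1)[of \<alpha>] that unfolding S_def by (intro thick_mono[OF T(1)]) (auto simp: thick_def)
  then have space: "space (M \<alpha>) = S \<alpha>" if "\<alpha> \<in> {0..1}" for \<alpha>
    using that unfolding M_def thick_def by (intro space_trace_measure) auto
  have "prob_space unit_lborel"
    by (rule prob_space_restrict_space) auto
  then have "prob_space (M \<alpha>) \<and> uniformly_distributed (M \<alpha>) (\<lambda>x. x)" if "\<alpha> \<in> {0..1}" for \<alpha>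
    using S[OF that] unfolding M_def
    by (simp add: prob_space_trace_measure uniformly_distributed_trace_measure)
  moreover have "inner_measure_of unit_lborel (S \<alpha> \<inter> S \<beta>) = ennreal (min \<alpha> \<beta>) \<and>
       outer_measure_of unit_lborel (S \<alpha> \<inter> S \<beta>) = ennreal (max \<alpha> \<beta>)"
    if "\<alpha> \<in> {0..1}" "\<beta> \<in> {0..1}" "\<alpha> \<noteq> \<beta>" for \<alpha> \<beta>
    using that
  proof (induction \<alpha> \<beta> rule: linorder_wlog)
    case (le \<alpha> \<beta>)
    then show ?case
      using inner_outer_measure_Int[OF T(1) T(1) disj, of \<alpha> \<beta> \<alpha> \<beta>] by (simp add: S_def)
  next
    case (sym \<beta> \<alpha>)
    then show ?case
      by (simp add: Int_commute min.commute max.commute)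
  qed
  ultimately show ?thesis
    by (intro exI[of _ M] exI[of _ "\<lambda>_ x. x"]) (simp add: space)
qed

end
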